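(* Let $\mathbf d=(d_1,\ldots,d_n)\in\mathbb{N}_0^n$ be a multi-degree, $s=(d_1+1)\cdots(d_n+1)$, and let $D=[a_1,a_1+2^{k_1}]\times\cdots\times[a_n,a_n+2^{k_n}]$, where $(a_1,\ldots,a_n)\in\mathbb{Z}^n$ and $\mathbf k=(k_1,\ldots,k_n)\in\mathbb{N}_0^n$ are fixed. For every $q_1,\ldots,q_r\in\mathbb{Z}[x_1,\ldots,x_n]_{\le\mathbf d}$ there exists a matrix $v\in\mathbb{Q}^{s\times r}$ such that for every box $D'\subseteq D$ of the form \[ D'=[z_1,z_1+2^{k_1'}]\times\cdots\times[z_n,z_n+2^{k_n'}],\qquad z_i=a_i+l_i2^{k_i'},\quad 0\le k_i'\le k_i,\quad 0\le l_i<2^{k_i-k_i'},\quad k_i',l_i\in\mathbb{N}_0,\quad 1\le i\le n, \] there exists a $(\mathbf d,\mathbf k-\mathbf k')$-subdivision matrix $M\in\mathbb{Q}^{s\times s}$ (where $\mathbf k'=(k_1',\ldots,k_n')$) such that $w=Mv$ satisfies: (1) $w_{1i}=q_i(z_1,\ldots,z_n)$ for $1\le i\le r$; (2) $\min(\{w_{ji}\}_{j=1}^s)\le q_i(\mathbf x)\le\max(\{w_{ji}\}_{j=1}^s)$ for all $1\le i\le r$ and all $\mathbf x\in D'$.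
   Context: $\mathbb{Z}[x_1,\ldots,x_n]_{\le\mathbf d}$ (and similarly over $\mathbb R$) denotes polynomials of degree at most $d_i$ in $x_i$ for each $i$. The $\mathbf d$-Bernstein basis of $\mathbb{R}[\mathbf x]_{\le\mathbf d}$ is the set of polynomials $B_{\mathbf d,\mathbf k}(\mathbf x)=\prod_{i=1}^n\binom{d_i}{k_i}x_i^{k_i}(1-x_i)^{d_i-k_i}$, $\mathbf 0\le\mathbf k\le\mathbf d$, ordered lexicographically by $\mathbf k$ (so $\mathbf k=\mathbf 0$ is first); it has $s=(d_1+1)\cdots(d_n+1)$ elements. For a box $E=\prod_i[\alpha_i,\beta_i]\subset\mathbb{R}^n$, let $\varphi_E(\mathbf x)=(\alpha_i+(\beta_i-\alpha_i)x_i)_{i=1}^n$, which maps $[0,1]^n$ onto $E$; the matrix associated to the box $E$ and to the multi-degree $\mathbf d$ is the $s\times s$ matrix, acting on column vectors of coordinates in the $\mathbf d$-Bernstein basis, of the linear map $q\mapsto q\circ\varphi_E$ on $\mathbb{R}[\mathbf x]_{\le\mathbf d}$. $M_i^L$ (resp. $M_i^R$) denotes the matrix associated to $[0,1]^{i-1}\times[0,1/2]\times[0,1]^{n-i}$ (resp. $[0,1]^{i-1}\times[1/2,1]\times[0,1]^{n-i}$) and to $\mathbf d$; these are rational matrices. For $\mathbf m=(m_1,\ldots,m_n)\in\mathbb{N}_0^n$, a $(\mathbf d,\mathbf m)$-subdivision matrix is a product \[ M_1^{f_1(1)}\cdots M_1^{f_1(m_1)}\,M_2^{f_2(1)}\cdots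 M_2^{f_2(m_2)}\cdots M_n^{f_n(1)}\cdots M_n^{f_n(m_n)} \] for some functions $f_i:\{1,\ldots,m_i\}\to\{L,R\}$ (when $m_i=0$ the corresponding factor is the identity). *)

theory Defs
  imports
    "HOL-Library.Poly_Mapping"
    "Jordan_Normal_Form.Matrix"
begin

text \<open>
  Everything is indexed from 0: the variables are \<open>0, \<dots>, n - 1\<close>, and rows and columns of
  matrices start at 0. Multi-degrees and the like are functions on \<^typ>\<open>nat\<close> of which only the
  values below \<open>n\<close> matter.
\<close>

type_synonym 'a mpoly = "(nat \<Rightarrow>\<^sub>0 nat) \<Rightarrow>\<^sub>0 'a"

definition Const :: "'a::zero \<Rightarrow> 'a mpoly" where
  "Const c = Poly_Mapping.single 0 c"

definition Var :: "nat \<Rightarrow> 'a::zero_neq_one mpoly" where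
  "Var i = Poly_Mapping.single (Poly_Mapping.single i 1) 1"

text \<open>Apply \<open>h\<close> to the coefficients and substitute \<open>x i\<close> for the \<open>i\<close>-th variable. With
  \<open>h = of_int\<close> this evaluates an integer polynomial at a point, with \<open>h = Const\<close> it composes
  polynomials.\<close>

definition mpoly_subst :: "('a::zero \<Rightarrow> 'b::comm_semiring_1) \<Rightarrow> (nat \<Rightarrow> 'b) \<Rightarrow> 'a mpoly \<Rightarrow> 'b" where
  "mpoly_subst h x p =
     (\<Sum>m\<in>Poly_Mapping.keys p. h (Poly_Mapping.lookup p m) *
        (\<Prod>i\<in>Poly_Mapping.keys m. x i ^ Poly_Mapping.lookup m i))"

definition mpolys_le :: "nat \<Rightarrow> (nat \<Rightarrow> nat) \<Rightarrow> ('a::zero) mpoly set" where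
  "mpolys_le n d = {p. \<forall>m\<in>Poly_Mapping.keys p.
     Poly_Mapping.keys m \<subseteq> {..<n} \<and> (\<forall>i<n. Poly_Mapping.lookup m i \<le> d i)}"

text \<open>The multi-indices \<open>0 \<le> \<kappa> \<le> d\<close> as lists of length \<open>n\<close>, in lexicographic order
  (see the lemmas below).\<close>

definition multi_indices :: "nat \<Rightarrow> (nat \<Rightarrow> nat) \<Rightarrow> nat list list" where
  "multi_indices n d = product_lists (map (\<lambda>i. [0..<Suc (d i)]) [0..<n])"

definition bernstein_dim :: "nat \<Rightarrow> (nat \<Rightarrow> nat) \<Rightarrow> nat" where
  "bernstein_dim n d = (\<Prod>i<n. d i + 1)"

lemma set_multi_indices:
  "set (multi_indices n d) = {\<kappa>. length \<kappa> = n \<and> (\<forall>i<n. \<kappa> ! i \<le> d i)}"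
  by (auto simp: multi_indices_def product_lists_set list_all2_conv_all_nth less_Suc_eq_le
      simp del: upt_Suc)

lemma length_multi_indices: "length (multi_indices n d) = bernstein_dim n d"
proof -
  have *: "length (product_lists (map (\<lambda>i. [0..<Suc (d i)]) xs)) = prod_list (map (\<lambda>i. d i + 1) xs)"
    for xs
    by (induction xs) (simp_all add: length_concat comp_def sum_list_triv del: upt_Suc)
  show ?thesis
    by (simp add: multi_indices_def * bernstein_dim_def interv_sum_list_conv_sum_set_nat
        prod.list_conv_set_nth lessThan_atLeast0 del: upt_Suc)
qed

lemma sorted_multi_indices:
  "sorted_wrt (\<lambda>\<kappa> \<kappa>'. (\<kappa>, \<kappa>') \<in> lex less_than) (multi_indices n d)"
proof -
  have step: "sorted_wrt (\<lambda>x y. (x, y) \<in> lex less_than) (concat (map (\<lambda>x. map ((#) x) yss) xs))"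
    if "sorted_wrt (<) xs" "sorted_wrt (\<lambda>x y. (x, y) \<in> lex less_than) yss"
      "\<forall>ys\<in>set yss. length ys = N"
    for xs :: "nat list" and yss :: "nat list list" and N
    using that by (induction xs) (auto simp: sorted_wrt_append sorted_wrt_map)
  have "sorted_wrt (\<lambda>x y. (x, y) \<in> lex less_than) (product_lists (map (\<lambda>i. [0..<Suc (d i)]) xs))"
    for xs
  proof (induction xs)
    case (Cons i xs)
    show ?case
      using step[OF _ Cons.IH, of "[0..<Suc (d i)]" "length xs"]
      by (auto simp: in_set_product_lists_length strict_sorted_iff simp del: upt_Suc)
  qed simp
  then show ?thesis by (simp add: multi_indices_def)
qed

definition bernstein :: "nat \<Rightarrow> (nat \<Rightarrow> nat) \<Rightarrow> nat list \<Rightarrow> real mpoly" where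
  "bernstein n d \<kappa> =
     (\<Prod>i<n. Const (of_nat (d i choose (\<kappa> ! i))) * Var i ^ (\<kappa> ! i) * (1 - Var i) ^ (d i - \<kappa> ! i))"

text \<open>The polynomial with coordinate vector \<open>c\<close> in the Bernstein basis.\<close>

definition of_bernstein_coords :: "nat \<Rightarrow> (nat \<Rightarrow> nat) \<Rightarrow> real vec \<Rightarrow> real mpoly" where
  "of_bernstein_coords n d c =
     (\<Sum>j<bernstein_dim n d. Const (c $ j) * bernstein n d (multi_indices n d ! j))"

text \<open>The map \<open>\<phi>\<^sub>E\<close> from the unit cube to the box \<open>E = \<Prod>i. [\<alpha> i, \<beta> i]\<close>, as a tuple of
  polynomials.\<close>

definition box_map :: "(nat \<Rightarrow> real) \<Rightarrow> (nat \<Rightarrow> real) \<Rightarrow> nat \<Rightarrow> real mpoly" where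
  "box_map \<alpha> \<beta> i = Const (\<alpha> i) + Const (\<beta> i - \<alpha> i) * Var i"

text \<open>The matrix, in Bernstein coordinates, of the linear map \<open>q \<mapsto> q \<circ> \<phi>\<^sub>E\<close>.\<close>

definition box_matrix :: "nat \<Rightarrow> (nat \<Rightarrow> nat) \<Rightarrow> (nat \<Rightarrow> real) \<Rightarrow> (nat \<Rightarrow> real) \<Rightarrow> real mat" where
  "box_matrix n d \<alpha> \<beta> =
     (THE A. A \<in> carrier_mat (bernstein_dim n d) (bernstein_dim n d) \<and>
        (\<forall>c\<in>carrier_vec (bernstein_dim n d).
           mpoly_subst Const (box_map \<alpha> \<beta>) (of_bernstein_coords n d c) =
           of_bernstein_coords n d (A *\<^sub>v c)))"

datatype side = Left | Right

fun half_matrix :: "nat \<Rightarrow> (nat \<Rightarrow> nat) \<Rightarrow> nat \<Rightarrow> side \<Rightarrow> real mat" where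
  "half_matrix n d i Left = box_matrix n d (\<lambda>_. 0) ((\<lambda>_. 1)(i := 1/2))"
| "half_matrix n d i Right = box_matrix n d ((\<lambda>_. 0)(i := 1/2)) (\<lambda>_. 1)"

definition is_subdivision_matrix ::
  "nat \<Rightarrow> (nat \<Rightarrow> nat) \<Rightarrow> (nat \<Rightarrow> nat) \<Rightarrow> real mat \<Rightarrow> bool" where
  "is_subdivision_matrix n d m M \<longleftrightarrow>
     (\<exists>f :: nat \<Rightarrow> nat \<Rightarrow> side.
        M = foldr (*) (concat (map (\<lambda>i. map (\<lambda>j. half_matrix n d i (f i j)) [0..<m i]) [0..<n]))
              (1\<^sub>m (bernstein_dim n d)))"

definition closed_box :: "nat \<Rightarrow> (nat \<Rightarrow> int) \<Rightarrow> (nat \<Rightarrow> nat) \<Rightarrow> (nat \<Rightarrow> real) set" where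
  "closed_box n a k = (\<Pi>\<^sub>E i\<in>{..<n}. {real_of_int (a i) .. real_of_int (a i) + 2 ^ k i})"

end

theory Submission
  imports Defs "Jordan_Normal_Form.Char_Poly"
begin

text \<open>
  Take for \<open>v\<close> the matrix whose \<open>i\<close>-th column holds the Bernstein coordinates of \<open>q i\<close> composed with the
  affine map from the unit cube onto the large box. A subdivision matrix composes this polynomial
  further with a map from the unit cube onto a dyadic subcube. Halving a side repeatedly, with the
  half chosen according to the binary digits of \<open>l i\<close>, reaches the subinterval number \<open>l i\<close>
  among the \<open>2 ^ (k i - k' i)\<close> equal ones; so for the right choice of halves, the columns of \<open>M * v\<close> are
  the Bernstein coordinates of \<open>q i\<close> composed with the map from the unit cube onto the small box
  (\<open>bern_eval_half_mats\<close>, \<open>fold_half_point_bit_ops\<close>).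

  The two conclusions are then classical properties of the Bernstein form. The first coordinate
  is the value at the corner of the box (\<open>bern_eval_0\<close>). All values on the box are convex
  combinations of the coordinates, as the Bernstein polynomials form a partition of unity
  (\<open>bern_eval_bounds\<close>).

  The box matrices are given by a definite description, so they have to be computed. In one
  variable, \<open>poly_eq_sum_bern\<close> gives the Bernstein coordinates of a polynomial explicitly, over any
  field of characteristic zero. Affine maps of a box act on each variable separately, hence
  their matrix is the Kronecker product of univariate ones (\<open>tensor_comb_bern_affine\<close>); in particular it is
  rational if the box is. Uniqueness is the linear independence of the Bernstein polynomials
  (\<open>bernstein_independent\<close>).
\<close>

section \<open>Univariate Bernstein polynomials\<close>

text \<open>The argument ranges over an arbitrary commutative ring, so that one definition covers polynomials
  in one variable, multivariate polynomials (with \<open>x\<close> a variable or an affine form in it) and real numbers.\<close>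

definition bern :: "nat \<Rightarrow> nat \<Rightarrow> 'a::comm_ring_1 \<Rightarrow> 'a" where
  "bern d k x = of_nat (d choose k) * x ^ k * (1 - x) ^ (d - k)"

lemma sum_bern: "(\<Sum>k\<le>d. bern d k x) = 1"
  using binomial_ring[of x "1 - x" d] by (simp add: bern_def)

text \<open>Multiply \<open>x ^ k\<close> by the partition of unity \<open>sum_bern\<close> of degree \<open>d - k\<close>; each resulting term is
  a multiple of a Bernstein polynomial of degree \<open>d\<close>. The homomorphism \<open>h\<close> makes the ring an algebra over the
  field in which the coefficients live.\<close>

lemma monomial_bern:
  fixes h :: "'b::field_char_0 \<Rightarrow> 'a::comm_ring_1"
  assumes h: "comm_ring_hom h" and k: "k \<le> d"
  shows "x ^ k = (\<Sum>l\<le>d. h (of_nat (l choose k) / of_nat (d choose k)) * bern d l x)"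
proof -
  interpret comm_ring_hom h by fact
  have eq: "h (of_nat (l choose k) / of_nat (d choose k)) * bern d l x = x ^ k * bern (d - k) (l - k) x"
    if "k \<le> l" "l \<le> d" for l
  proof -
    have "(d choose l) * (l choose k) = (d choose k) * ((d - k) choose (l - k))"
      using that by (rule choose_mult)
    then have "of_nat (l choose k) / of_nat (d choose k) * of_nat (d choose l)
        = (of_nat ((d - k) choose (l - k)) :: 'b)"
      using k by (simp add: field_simps flip: of_nat_mult)
    then have "h (of_nat (l choose k) / of_nat (d choose k)) * of_nat (d choose l)
        = of_nat ((d - k) choose (l - k))"
      by (metis hom_mult hom_of_nat)
    then have "h (of_nat (l choose k) / of_nat (d choose k)) * bern d l x
        = of_nat ((d - k) choose (l - k)) * x ^ l * (1 - x) ^ (d - l)"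
      unfolding bern_def by (metis mult.assoc)
    moreover have "x ^ l = x ^ k * x ^ (l - k)" "d - l = d - k - (l - k)"
      using that by (simp_all flip: power_add)
    ultimately show ?thesis
      by (simp only: bern_def mult_ac)
  qed
  have "x ^ k = x ^ k * (\<Sum>j\<le>d - k. bern (d - k) j x)"
    by (simp add: sum_bern)
  also have "\<dots> = (\<Sum>l\<in>{k..d}. x ^ k * bern (d - k) (l - k) x)"
    unfolding sum_distrib_left
    by (rule sum.reindex_bij_witness[of _ "\<lambda>l. l - k" "\<lambda>j. j + k"]) (use k in auto)
  also have "\<dots> = (\<Sum>l\<in>{k..d}. h (of_nat (l choose k) / of_nat (d choose k)) * bern d l x)"
    by (rule sum.cong) (auto simp: eq)
  also have "\<dots> = (\<Sum>l\<le>d. h (of_nat (l choose k) / of_nat (d choose k)) * bern d l x)"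
    by (rule sum.mono_neutral_left) (auto simp: binomial_eq_0)
  finally show ?thesis .
qed

text \<open>The coordinates of \<open>p\<close> in the Bernstein basis of degree \<open>d\<close>, from \<open>monomial_bern\<close> by
  linearity. Being explicit, they lie in the coefficient field of \<open>p\<close>; this is where the rationality of all
  matrices below comes from.\<close>

definition bern_coeff :: "nat \<Rightarrow> 'b::field_char_0 poly \<Rightarrow> nat \<Rightarrow> 'b" where
  "bern_coeff d p l = (\<Sum>k\<le>d. coeff p k * (of_nat (l choose k) / of_nat (d choose k)))"

lemma poly_map_poly_upto:
  assumes "comm_ring_hom h" "degree p \<le> d"
  shows "poly (map_poly h p) x = (\<Sum>k\<le>d. h (coeff p k) * x ^ k)"
proof -
  interpret comm_ring_hom h by fact
  show ?thesis
    using assms(2) degree_map_poly_le[of h p]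
    by (subst poly_as_sum_of_monoms'[of "map_poly h p" d, symmetric])
       (auto simp: poly_sum poly_monom coeff_map_poly)
qed

lemma poly_eq_sum_bern:
  fixes h :: "'b::field_char_0 \<Rightarrow> 'a::comm_ring_1"
  assumes "comm_ring_hom h" "degree p \<le> d"
  shows "poly (map_poly h p) x = (\<Sum>l\<le>d. h (bern_coeff d p l) * bern d l x)"
proof -
  interpret comm_ring_hom h by fact
  have "poly (map_poly h p) x = (\<Sum>k\<le>d. h (coeff p k) *
      (\<Sum>l\<le>d. h (of_nat (l choose k) / of_nat (d choose k)) * bern d l x))"
    unfolding poly_map_poly_upto[OF assms]
    by (rule sum.cong) (auto simp: monomial_bern[OF assms(1), symmetric])
  also have "\<dots> = (\<Sum>l\<le>d. \<Sum>k\<le>d. h (coeff p k * (of_nat (l choose k) / of_nat (d choose k))) * bern d l x)"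
    by (subst sum.swap) (simp only: sum_distrib_left hom_mult mult.assoc)
  finally show ?thesis
    by (simp add: bern_coeff_def hom_sum sum_distrib_right)
qed

lemma degree_affine_power: "degree ([:\<alpha>, \<gamma>:] ^ k) \<le> k"
  for \<alpha> \<gamma> :: "'b::field"
  using degree_power_le[of "[:\<alpha>, \<gamma>:]" k] by (auto split: if_splits)

lemma degree_bern_affine:
  fixes \<alpha> \<gamma> :: "'b::field"
  assumes "k \<le> d"
  shows "degree (bern d k [:\<alpha>, \<gamma>:]) \<le> d"
proof -
  have "1 - [:\<alpha>, \<gamma>:] = [:1 - \<alpha>, - \<gamma>:]"
    by (simp add: one_pCons)
  then have "degree ([:\<alpha>, \<gamma>:] ^ k * (1 - [:\<alpha>, \<gamma>:]) ^ (d - k)) \<le> k + (d - k)"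
    using degree_mult_le[of "[:\<alpha>, \<gamma>:] ^ k" "(1 - [:\<alpha>, \<gamma>:]) ^ (d - k)"]
      degree_affine_power[of \<alpha> \<gamma> k] degree_affine_power[of "1 - \<alpha>" "- \<gamma>" "d - k"] by simp
  then show ?thesis
    using assms degree_mult_le[of "of_nat (d choose k)" "[:\<alpha>, \<gamma>:] ^ k * (1 - [:\<alpha>, \<gamma>:]) ^ (d - k)"]
    by (simp add: bern_def mult.assoc)
qed

lemma map_poly_linear:
  assumes "comm_ring_hom h"
  shows "map_poly h [:\<alpha>, \<gamma>:] = [:h \<alpha>, h \<gamma>:]"
proof -
  interpret comm_ring_hom h by fact
  show ?thesis
    by (rule poly_eqI) (simp add: coeff_map_poly coeff_pCons split: nat.split)
qed

lemma map_poly_affine: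
  assumes "comm_ring_hom h"
  shows "poly (map_poly h ([:\<alpha>, \<gamma>:] ^ k)) x = (h \<alpha> + h \<gamma> * x) ^ k"
    and "poly (map_poly h (bern d k [:\<alpha>, \<gamma>:])) x = bern d k (h \<alpha> + h \<gamma> * x)"
proof -
  interpret comm_ring_hom h by fact
  interpret m: map_poly_comm_ring_hom h ..
  show "poly (map_poly h ([:\<alpha>, \<gamma>:] ^ k)) x = (h \<alpha> + h \<gamma> * x) ^ k"
    by (simp add: m.hom_power map_poly_linear[OF assms] mult.commute)
  have nat: "map_poly h (of_nat m) = of_nat m" for m
    by (rule m.hom_of_nat)
  show "poly (map_poly h (bern d k [:\<alpha>, \<gamma>:])) x = bern d k (h \<alpha> + h \<gamma> * x)"
    by (simp add: bern_def m.hom_power m.hom_mult m.hom_minus nat map_poly_linear[OF assms] mult.commute)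
qed

section \<open>Tensor products of univariate bases\<close>

abbreviation midx :: "nat \<Rightarrow> (nat \<Rightarrow> nat) \<Rightarrow> nat \<Rightarrow> nat list" where
  "midx n d j \<equiv> multi_indices n d ! j"

text \<open>The lexicographic order is irreflexive, so a strictly sorted list has no repetitions.\<close>

lemma distinct_multi_indices: "distinct (multi_indices n d)"
proof -
  have "(\<kappa>, \<kappa>) \<notin> lex less_than" for \<kappa> :: "nat list"
    by (meson wf_less_than wf_lex wf_not_refl)
  then show ?thesis
    using sorted_multi_indices[of n d]
    by (metis distinct_conv_nth linorder_neqE_nat sorted_wrt_iff_nth_less)
qed

lemma bij_midx: "bij_betw (midx n d) {..<bernstein_dim n d} {\<kappa>. length \<kappa> = n \<and> (\<forall>i<n. \<kappa> ! i \<le> d i)}"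
  using bij_betw_nth[OF distinct_multi_indices refl refl, of n d]
  by (simp add: set_multi_indices length_multi_indices)

lemma midx_le: "j < bernstein_dim n d \<Longrightarrow> i < n \<Longrightarrow> midx n d j ! i \<le> d i"
  using bij_betwE[OF bij_midx] by blast

text \<open>Distributivity. It turns a fact about each variable separately into one about the tensor
  product basis, which is how all the univariate identities are lifted to several variables.\<close>

lemma prod_sum_multi_indices:
  fixes f :: "nat \<Rightarrow> nat \<Rightarrow> 'a::comm_semiring_1"
  shows "(\<Prod>i<n. \<Sum>l\<le>d i. f i l) = (\<Sum>j<bernstein_dim n d. \<Prod>i<n. f i (midx n d j ! i))"
proof -
  have "(\<Prod>i<n. \<Sum>l\<le>d i. f i l) = (\<Sum>p\<in>(\<Pi>\<^sub>E i\<in>{..<n}. {..d i}). \<Prod>i<n. f i (p i))"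
    by (rule prod_sum_PiE) auto
  also have "\<dots> = (\<Sum>\<kappa>\<in>{\<kappa>. length \<kappa> = n \<and> (\<forall>i<n. \<kappa> ! i \<le> d i)}. \<Prod>i<n. f i (\<kappa> ! i))"
    by (rule sum.reindex_bij_witness[of _ "\<lambda>\<kappa>. restrict ((!) \<kappa>) {..<n}" "\<lambda>p. map p [0..<n]"])
       (auto simp: PiE_iff extensional_def fun_eq_iff restrict_def intro!: nth_equalityI)
  also have "\<dots> = (\<Sum>j<bernstein_dim n d. \<Prod>i<n. f i (midx n d j ! i))"
    by (rule sum.reindex_bij_betw[OF bij_midx, symmetric])
  finally show ?thesis .
qed

text \<open>The element with coordinates \<open>c\<close> with respect to the family of products of univariate families
  \<open>u 0, \<dots>, u (n - 1)\<close>. For suitable \<open>u\<close> it expresses a multivariate polynomial in Bernstein form or in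
  monomial form, its composite with an affine map, or the value of either at a point.\<close>

definition tensor_comb ::
  "('b \<Rightarrow> 'a::comm_ring_1) \<Rightarrow> nat \<Rightarrow> (nat \<Rightarrow> nat) \<Rightarrow> (nat \<Rightarrow> nat \<Rightarrow> 'a) \<Rightarrow> 'b vec \<Rightarrow> 'a" where
  "tensor_comb h n d u c = (\<Sum>j<bernstein_dim n d. h (c $ j) * (\<Prod>i<n. u i (midx n d j ! i)))"

definition kron_mat :: "nat \<Rightarrow> (nat \<Rightarrow> nat) \<Rightarrow> (nat \<Rightarrow> nat \<Rightarrow> nat \<Rightarrow> 'b::comm_ring_1) \<Rightarrow> 'b mat" where
  "kron_mat n d e = mat (bernstein_dim n d) (bernstein_dim n d)
     (\<lambda>(j, k). \<Prod>i<n. e i (midx n d j ! i) (midx n d k ! i))"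

lemma kron_mat_carrier [simp, intro]:
  "kron_mat n d e \<in> carrier_mat (bernstein_dim n d) (bernstein_dim n d)"
  by (simp add: kron_mat_def)

text \<open>If \<open>e i\<close> is the transition matrix in the \<open>i\<close>-th variable, expanding the products of sums by
  \<open>prod_sum_multi_indices\<close> yields the entries of the Kronecker product.\<close>

lemma tensor_comb_change_basis:
  assumes h: "comm_ring_hom h"
    and u: "\<And>i k. i < n \<Longrightarrow> k \<le> d i \<Longrightarrow> u i k = (\<Sum>l\<le>d i. h (e i l k) * u' i l)"
    and c: "c \<in> carrier_vec (bernstein_dim n d)"
  shows "tensor_comb h n d u c = tensor_comb h n d u' (kron_mat n d e *\<^sub>v c)"
proof -
  interpret comm_ring_hom h by fact
  let ?s = "bernstein_dim n d"
  have "(\<Prod>i<n. u i (midx n d k ! i)) =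
      (\<Sum>j<?s. h (kron_mat n d e $$ (j, k)) * (\<Prod>i<n. u' i (midx n d j ! i)))" if "k < ?s" for k
  proof -
    have "(\<Prod>i<n. u i (midx n d k ! i)) = (\<Prod>i<n. \<Sum>l\<le>d i. h (e i l (midx n d k ! i)) * u' i l)"
      by (rule prod.cong) (auto simp: u midx_le that)
    also have "\<dots> = (\<Sum>j<?s. \<Prod>i<n. h (e i (midx n d j ! i) (midx n d k ! i)) * u' i (midx n d j ! i))"
      by (rule prod_sum_multi_indices)
    finally show ?thesis
      by (simp add: prod.distrib hom_prod kron_mat_def that)
  qed
  then have "tensor_comb h n d u c = (\<Sum>k<?s. \<Sum>j<?s. h (kron_mat n d e $$ (j, k) * c $ k) *
      (\<Prod>i<n. u' i (midx n d j ! i)))"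
    by (simp add: tensor_comb_def sum_distrib_left hom_mult mult_ac)
  also have "\<dots> = (\<Sum>j<?s. (\<Sum>k<?s. h (kron_mat n d e $$ (j, k) * c $ k)) *
      (\<Prod>i<n. u' i (midx n d j ! i)))"
    by (subst sum.swap) (simp add: sum_distrib_right)
  also have "\<dots> = tensor_comb h n d u' (kron_mat n d e *\<^sub>v c)"
    unfolding tensor_comb_def
  proof (rule sum.cong)
    fix j assume "j \<in> {..<?s}"
    then have "(kron_mat n d e *\<^sub>v c) $ j = (\<Sum>k<?s. kron_mat n d e $$ (j, k) * c $ k)"
      using c
      by (auto simp: kron_mat_def scalar_prod_def lessThan_atLeast0 intro!: sum.cong)
    then show "(\<Sum>k<?s. h (kron_mat n d e $$ (j, k) * c $ k)) * (\<Prod>i<n. u' i (midx n d j ! i)) =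
      h ((kron_mat n d e *\<^sub>v c) $ j) * (\<Prod>i<n. u' i (midx n d j ! i))"
      by (simp add: hom_sum)
  qed simp
  finally show ?thesis .
qed

section \<open>Substitution into multivariate polynomials\<close>

lemma comm_ring_hom_Const: "comm_ring_hom (Const :: 'a::comm_ring_1 \<Rightarrow> 'a mpoly)"
  by unfold_locales (simp_all add: Const_def single_add mult_single)

lemma prod_keys_superset:
  fixes x :: "nat \<Rightarrow> 'a::comm_semiring_1"
  assumes "finite S" "Poly_Mapping.keys m \<subseteq> S"
  shows "(\<Prod>i\<in>Poly_Mapping.keys m. x i ^ Poly_Mapping.lookup m i) = (\<Prod>i\<in>S. x i ^ Poly_Mapping.lookup m i)"
  using assms by (intro prod.mono_neutral_left) (auto simp: in_keys_iff)

lemma prod_keys_add: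
  fixes x :: "nat \<Rightarrow> 'a::comm_semiring_1"
  shows "(\<Prod>i\<in>Poly_Mapping.keys (a + b). x i ^ Poly_Mapping.lookup (a + b) i) =
    (\<Prod>i\<in>Poly_Mapping.keys a. x i ^ Poly_Mapping.lookup a i) *
    (\<Prod>i\<in>Poly_Mapping.keys b. x i ^ Poly_Mapping.lookup b i)"
proof -
  let ?S = "Poly_Mapping.keys a \<union> Poly_Mapping.keys b"
  have "Poly_Mapping.keys (a + b) \<subseteq> ?S"
    by (rule keys_add)
  then have "(\<Prod>i\<in>Poly_Mapping.keys (a + b). x i ^ Poly_Mapping.lookup (a + b) i) =
      (\<Prod>i\<in>?S. x i ^ Poly_Mapping.lookup (a + b) i)"
    by (intro prod_keys_superset) auto
  then show ?thesis
    using prod_keys_superset[of ?S a x] prod_keys_superset[of ?S b x]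
    by (simp add: lookup_add power_add prod.distrib)
qed

context
  fixes h :: "'a::comm_ring_1 \<Rightarrow> 'b::comm_ring_1" and x :: "nat \<Rightarrow> 'b"
  assumes h: "comm_ring_hom h"
begin

interpretation comm_ring_hom h by (fact h)

lemma mpoly_subst_superset:
  assumes "finite S" "Poly_Mapping.keys p \<subseteq> S"
  shows "mpoly_subst h x p = (\<Sum>m\<in>S. h (Poly_Mapping.lookup p m) *
    (\<Prod>i\<in>Poly_Mapping.keys m. x i ^ Poly_Mapping.lookup m i))"
  unfolding mpoly_subst_def using assms
  by (intro sum.mono_neutral_left) (auto simp: in_keys_iff)

lemma mpoly_subst_add: "mpoly_subst h x (p + q) = mpoly_subst h x p + mpoly_subst h x q"
proof -
  let ?S = "Poly_Mapping.keys p \<union> Poly_Mapping.keys q"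
  have "Poly_Mapping.keys (p + q) \<subseteq> ?S"
    by (rule keys_add)
  then show ?thesis
    by (simp add: mpoly_subst_superset[of ?S] lookup_add hom_add distrib_right sum.distrib)
qed

lemma mpoly_subst_zero: "mpoly_subst h x 0 = 0"
  by (simp add: mpoly_subst_def)

lemma mpoly_subst_sum: "mpoly_subst h x (sum f A) = (\<Sum>a\<in>A. mpoly_subst h x (f a))"
  by (induction A rule: infinite_finite_induct) (simp_all add: mpoly_subst_add mpoly_subst_zero)

lemma mpoly_subst_single:
  "mpoly_subst h x (Poly_Mapping.single m c) =
     h c * (\<Prod>i\<in>Poly_Mapping.keys m. x i ^ Poly_Mapping.lookup m i)"
  by (subst mpoly_subst_superset[of "{m}"]) (auto simp: in_keys_iff lookup_single when_def)

lemma mpoly_subst_mult: "mpoly_subst h x (p * q) = mpoly_subst h x p * mpoly_subst h x q"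
proof -
  \<comment> \<open>By additivity it is enough to treat monomials, where \<open>prod_keys_add\<close> applies.\<close>
  have expand: "r = (\<Sum>m\<in>Poly_Mapping.keys r. Poly_Mapping.single m (Poly_Mapping.lookup r m))"
    for r :: "'a mpoly"
    by (rule poly_mapping_eqI)
       (simp add: lookup_sum lookup_single when_def in_keys_iff)
  have "p * q = (\<Sum>a\<in>Poly_Mapping.keys p. \<Sum>b\<in>Poly_Mapping.keys q.
      Poly_Mapping.single (a + b) (Poly_Mapping.lookup p a * Poly_Mapping.lookup q b))"
    by (subst (1) expand[of p], subst (1) expand[of q]) (simp add: sum_product mult_single)
  then show ?thesis
    by (simp add: mpoly_subst_sum mpoly_subst_single prod_keys_add hom_mult mult_ac)
       (simp add: mpoly_subst_def sum_product mult_ac)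
qed

lemma comm_ring_hom_mpoly_subst: "comm_ring_hom (mpoly_subst h x)"
proof
  show "mpoly_subst h x 1 = 1"
    using mpoly_subst_single[of 0 1] by simp
qed (simp_all add: mpoly_subst_add mpoly_subst_zero mpoly_subst_mult)

lemma mpoly_subst_Const: "mpoly_subst h x (Const c) = h c"
  by (simp add: Const_def mpoly_subst_single)

lemma mpoly_subst_Var: "mpoly_subst h x (Var i) = x i"
  by (simp add: Var_def mpoly_subst_single)

end

text \<open>From here on, a polynomial in Bernstein form is a \<open>tensor_comb\<close>, and composing it with \<open>\<phi>\<close> amounts
  to evaluating the univariate Bernstein polynomials at \<open>\<phi> i\<close> instead of \<open>Var i\<close>.\<close>

lemma of_bernstein_coords_eq:
  "of_bernstein_coords n d c = tensor_comb Const n d (\<lambda>i k. bern (d i) k (Var i)) c"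
proof -
  have "Const (of_nat m) = (of_nat m :: real mpoly)" for m
    using comm_ring_hom_Const[where 'a = real]
    by (rule semiring_hom.hom_of_nat[OF ring_hom.axioms(1)[OF comm_ring_hom.axioms(1)]])
  then show ?thesis
    by (simp add: of_bernstein_coords_def tensor_comb_def bernstein_def bern_def)
qed

lemma mpoly_subst_of_bernstein_coords:
  "mpoly_subst Const \<phi> (of_bernstein_coords n d c) =
     tensor_comb Const n d (\<lambda>i k. bern (d i) k (\<phi> i)) c"
proof -
  interpret comm_ring_hom "mpoly_subst Const \<phi> :: real mpoly \<Rightarrow> real mpoly"
    by (rule comm_ring_hom_mpoly_subst[OF comm_ring_hom_Const])
  have *: "mpoly_subst Const \<phi> (of_nat m) = of_nat m" for m
    by (rule hom_of_nat)
  show ?thesis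
    by (simp add: of_bernstein_coords_eq tensor_comb_def bern_def * hom_sum hom_mult hom_prod hom_power
        hom_minus mpoly_subst_Const[OF comm_ring_hom_Const] mpoly_subst_Var[OF comm_ring_hom_Const])
qed

section \<open>The matrix associated to a box\<close>

text \<open>Composition with \<open>x i \<mapsto> \<alpha> i + \<gamma> i * x i\<close> acts on each variable separately, hence by a Kronecker
  product; column \<open>k\<close> of the \<open>i\<close>-th factor holds the Bernstein coordinates of the \<open>k\<close>-th Bernstein
  polynomial composed with \<open>\<alpha> i + \<gamma> i * x\<close>.\<close>

definition box_coeff_mat :: "nat \<Rightarrow> (nat \<Rightarrow> nat) \<Rightarrow> (nat \<Rightarrow> 'b) \<Rightarrow> (nat \<Rightarrow> 'b) \<Rightarrow> 'b::field_char_0 mat" where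
  "box_coeff_mat n d \<alpha> \<gamma> = kron_mat n d (\<lambda>i l k. bern_coeff (d i) (bern (d i) k [:\<alpha> i, \<gamma> i:]) l)"

text \<open>The defining property of a box matrix, in every algebra over the coefficient field: with
  multivariate polynomials it identifies \<open>box_matrix\<close>, with real numbers it describes the values of
  the transformed polynomial.\<close>

lemma tensor_comb_bern_affine:
  assumes h: "comm_ring_hom h" and c: "c \<in> carrier_vec (bernstein_dim n d)"
  shows "tensor_comb h n d (\<lambda>i k. bern (d i) k (h (\<alpha> i) + h (\<gamma> i) * x i)) c =
    tensor_comb h n d (\<lambda>i k. bern (d i) k (x i)) (box_coeff_mat n d \<alpha> \<gamma> *\<^sub>v c)"
  unfolding box_coeff_mat_def
proof (rule tensor_comb_change_basis[OF h _ c])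
  fix i k assume "k \<le> d i"
  then show "bern (d i) k (h (\<alpha> i) + h (\<gamma> i) * x i) =
    (\<Sum>l\<le>d i. h (bern_coeff (d i) (bern (d i) k [:\<alpha> i, \<gamma> i:]) l) * bern (d i) l (x i))"
    by (metis map_poly_affine(2)[OF h] poly_eq_sum_bern[OF h] degree_bern_affine)
qed

text \<open>The coefficient vector can be read off the polynomial, since distinct multi-indices give
  distinct exponents.\<close>

lemma monomials_independent:
  assumes c: "c \<in> carrier_vec (bernstein_dim n d)" "c' \<in> carrier_vec (bernstein_dim n d)"
    and eq: "tensor_comb Const n d (\<lambda>i k. Var i ^ k) c = tensor_comb Const n d (\<lambda>i k. Var i ^ k) c'"
  shows "c = (c' :: 'a::comm_ring_1 vec)"
proof -
  \<comment> \<open>The exponent of the \<open>j\<close>-th monomial.\<close>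
  define m where "m j = (\<Sum>i<n. Poly_Mapping.single i (midx n d j ! i))" for j
  have pow: "Var i ^ k = (Poly_Mapping.single (Poly_Mapping.single i k) 1 :: 'a mpoly)" for i k
    by (induction k) (simp_all add: Var_def mult_single single_add[symmetric])
  have prod: "(\<Prod>i\<in>S. Poly_Mapping.single (f i) 1) = (Poly_Mapping.single (sum f S) 1 :: 'a mpoly)"
    if "finite S" for f and S :: "nat set"
    using that by (induction S) (simp_all add: mult_single)
  have comb: "tensor_comb Const n d (\<lambda>i k. Var i ^ k) c =
      (\<Sum>j<bernstein_dim n d. Poly_Mapping.single (m j) (c $ j))" for c :: "'a vec"
    by (simp add: tensor_comb_def Const_def pow prod mult_single m_def)
  have inj: "j = j'" if "j < bernstein_dim n d" "j' < bernstein_dim n d" "m j = m j'" for j j'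
  proof -
    have "Poly_Mapping.lookup (m j) i = midx n d j ! i" if "i < n" for i j
      using that by (simp add: m_def lookup_sum lookup_single when_def)
    then have "midx n d j = midx n d j'"
      using bij_betwE[OF bij_midx[of n d]] that by (intro nth_equalityI) (auto, metis)
    then show ?thesis
      using bij_midx[of n d] that by (auto simp: bij_betw_def inj_on_def)
  qed
  have "Poly_Mapping.lookup (tensor_comb Const n d (\<lambda>i k. Var i ^ k) c) (m j) = c $ j"
    if "j < bernstein_dim n d" for j and c :: "'a vec"
  proof -
    have "Poly_Mapping.lookup (tensor_comb Const n d (\<lambda>i k. Var i ^ k) c) (m j) =
        (\<Sum>j'<bernstein_dim n d. if j' = j then c $ j' else 0)"
      unfolding comb lookup_sum lookup_single when_def
      by (rule sum.cong) (use inj that in auto)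
    then show ?thesis
      using that by simp
  qed
  then show ?thesis
    using c eq by (intro eq_vecI) (auto, metis)
qed

lemma mat_eqI_mult_vec:
  fixes A B :: "'a::comm_ring_1 mat"
  assumes "A \<in> carrier_mat s s" "B \<in> carrier_mat s s" "\<And>c. c \<in> carrier_vec s \<Longrightarrow> A *\<^sub>v c = B *\<^sub>v c"
  shows "A = B"
proof (rule eq_matI)
  fix i j assume "i < dim_row B" "j < dim_col B"
  then show "A $$ (i, j) = B $$ (i, j)"
    using assms(1,2) assms(3)[of "unit_vec s j", THEN arg_cong[of _ _ "\<lambda>v. v $ i"]] by simp
qed (use assms in auto)

text \<open>Every monomial is a combination of Bernstein polynomials and conversely, with square transition
  matrices \<open>T\<close> and \<open>S\<close>. Independence of the monomials gives \<open>S * T = 1\<close>, and for square matrices this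
  implies \<open>T * S = 1\<close>, so Bernstein coordinates are determined by monomial coordinates.\<close>

lemma bernstein_independent:
  assumes c: "c \<in> carrier_vec (bernstein_dim n d)" "c' \<in> carrier_vec (bernstein_dim n d)"
    and eq: "of_bernstein_coords n d c = of_bernstein_coords n d c'"
  shows "c = c'"
proof -
  let ?s = "bernstein_dim n d"
  define T :: "real mat" where "T = kron_mat n d (\<lambda>i l k. of_nat (l choose k) / of_nat (d i choose k))"
  define S :: "real mat" where "S = kron_mat n d (\<lambda>i l k. coeff (bern (d i) k [:0, 1:]) l)"
  have carr: "S \<in> carrier_mat ?s ?s" "T \<in> carrier_mat ?s ?s"
    by (simp_all add: S_def T_def)
  note Const = comm_ring_hom_Const[where 'a = real]
  interpret Const: comm_ring_hom "Const :: real \<Rightarrow> real mpoly" by (fact Const)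
  have toB: "tensor_comb Const n d (\<lambda>i k. Var i ^ k) c = of_bernstein_coords n d (T *\<^sub>v c)"
    if "c \<in> carrier_vec ?s" for c
    unfolding T_def of_bernstein_coords_eq
    by (rule tensor_comb_change_basis[OF Const monomial_bern[OF Const] that])
  have toM: "of_bernstein_coords n d c = tensor_comb Const n d (\<lambda>i k. Var i ^ k) (S *\<^sub>v c)"
    if "c \<in> carrier_vec ?s" for c
    unfolding S_def of_bernstein_coords_eq
  proof (rule tensor_comb_change_basis[OF Const _ that])
    fix i k assume "k \<le> d i"
    then show "bern (d i) k (Var i) = (\<Sum>l\<le>d i. Const (coeff (bern (d i) k [:0, 1:]) l) * Var i ^ l :: real mpoly)"
      using poly_map_poly_upto[OF Const degree_bern_affine, of k "d i" 0 1 "Var i"]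
      by (simp add: map_poly_affine(2)[OF Const])
  qed
  have "S * T = 1\<^sub>m ?s"
  proof (rule mat_eqI_mult_vec)
    fix c :: "real vec" assume "c \<in> carrier_vec ?s"
    then show "S * T *\<^sub>v c = 1\<^sub>m ?s *\<^sub>v c"
      using toB[of c] toM[of "T *\<^sub>v c"] carr
      by (intro monomials_independent) (auto simp: assoc_mult_mat_vec[of _ ?s ?s _ ?s])
  qed (use carr in auto)
  then have TS: "T * S = 1\<^sub>m ?s"
    using mat_mult_left_right_inverse carr by blast
  have "S *\<^sub>v c = S *\<^sub>v c'"
    using eq c carr by (intro monomials_independent[of _ n d]) (auto simp: toM)
  then have "(T * S) *\<^sub>v c = (T * S) *\<^sub>v c'"
    using carr c by (simp add: assoc_mult_mat_vec[of _ ?s ?s _ ?s])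
  then show ?thesis
    using c by (simp add: TS)
qed

text \<open>Existence in the definite description is \<open>tensor_comb_bern_affine\<close>, uniqueness is
  \<open>bernstein_independent\<close>.\<close>

lemma box_matrix_eq: "box_matrix n d \<alpha> \<beta> = box_coeff_mat n d \<alpha> (\<lambda>i. \<beta> i - \<alpha> i)"
  unfolding box_matrix_def
proof (rule the_equality)
  let ?s = "bernstein_dim n d" and ?A = "box_coeff_mat n d \<alpha> (\<lambda>i. \<beta> i - \<alpha> i)"
  have A: "?A \<in> carrier_mat ?s ?s"
    by (simp add: box_coeff_mat_def)
  have *: "mpoly_subst Const (box_map \<alpha> \<beta>) (of_bernstein_coords n d c) = of_bernstein_coords n d (?A *\<^sub>v c)"
    if "c \<in> carrier_vec ?s" for c
    using tensor_comb_bern_affine[OF comm_ring_hom_Const that]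
    by (simp add: mpoly_subst_of_bernstein_coords box_map_def) (simp add: of_bernstein_coords_eq)
  then show "?A \<in> carrier_mat ?s ?s \<and> (\<forall>c\<in>carrier_vec ?s.
      mpoly_subst Const (box_map \<alpha> \<beta>) (of_bernstein_coords n d c) = of_bernstein_coords n d (?A *\<^sub>v c))"
    using A by blast
  fix B assume B: "B \<in> carrier_mat ?s ?s \<and> (\<forall>c\<in>carrier_vec ?s.
      mpoly_subst Const (box_map \<alpha> \<beta>) (of_bernstein_coords n d c) = of_bernstein_coords n d (B *\<^sub>v c))"
  show "B = ?A"
  proof (rule mat_eqI_mult_vec)
    fix c :: "real vec" assume "c \<in> carrier_vec ?s"
    then show "B *\<^sub>v c = ?A *\<^sub>v c"
      using * A B by (intro bernstein_independent[of _ n d]) auto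
  qed (use A B in auto)
qed

lemma map_mat_box_coeff_mat:
  "map_mat real_of_rat (box_coeff_mat n d \<alpha> \<gamma>) =
     box_coeff_mat n d (\<lambda>i. real_of_rat (\<alpha> i)) (\<lambda>i. real_of_rat (\<gamma> i))"
proof -
  have h: "comm_ring_hom real_of_rat"
    by unfold_locales
  interpret m: map_poly_comm_ring_hom real_of_rat ..
  have nat: "map_poly real_of_rat (of_nat m) = of_nat m" for m
    by (rule m.hom_of_nat)
  have "map_poly real_of_rat (bern dd k [:a, b:]) = bern dd k [:real_of_rat a, real_of_rat b:]" for dd k a b
    by (simp add: bern_def m.hom_power m.hom_mult m.hom_minus nat map_poly_linear[OF h])
  then have "real_of_rat (coeff (bern dd k [:a, b:]) i) = coeff (bern dd k [:real_of_rat a, real_of_rat b:]) i"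
    for dd k a b i
    by (metis coeff_map_poly of_rat_0)
  then show ?thesis
    by (intro eq_matI) (auto simp: box_coeff_mat_def kron_mat_def bern_coeff_def of_rat_prod of_rat_sum
        of_rat_mult of_rat_divide)
qed

section \<open>Values of polynomials in Bernstein form\<close>

lemma comm_ring_hom_real_of_rat: "comm_ring_hom real_of_rat"
  by unfold_locales

abbreviation bern_eval :: "nat \<Rightarrow> (nat \<Rightarrow> nat) \<Rightarrow> rat vec \<Rightarrow> (nat \<Rightarrow> real) \<Rightarrow> real" where
  "bern_eval n d c x \<equiv> tensor_comb real_of_rat n d (\<lambda>i k. bern (d i) k (x i)) c"

lemma bern_eval_cong: "(\<And>i. i < n \<Longrightarrow> x i = y i) \<Longrightarrow> bern_eval n d c x = bern_eval n d c y"
  by (simp add: tensor_comb_def)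

text \<open>At the origin all Bernstein polynomials vanish but the one with multi-index \<open>0\<close>, which has value
  \<open>1\<close> and comes first in the lexicographic order.\<close>

lemma bern_eval_0: "bern_eval n d c (\<lambda>_. 0) = real_of_rat (c $ 0)"
proof -
  let ?s = "bernstein_dim n d"
  have pos: "0 < ?s"
    by (simp add: bernstein_dim_def)
  have min: "(\<kappa>, replicate m 0) \<notin> lex less_than" for \<kappa> m
  proof (induction \<kappa> arbitrary: m)
    case (Cons a \<kappa>)
    then show ?case by (cases m) auto
  qed auto
  obtain j where j: "j < ?s" "midx n d j = replicate n 0"
  proof -
    have "replicate n 0 \<in> midx n d ` {..<?s}"
      by (simp add: bij_betw_imp_surj_on[OF bij_midx])
    then show ?thesis
      using that by auto
  qed
  have "j = 0"
    using sorted_wrt_nth_less[OF sorted_multi_indices[of n d], of 0 j] min[of "midx n d 0" n] j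
    by (auto simp: length_multi_indices)
  then have zero: "midx n d 0 = replicate n 0"
    using j by simp
  have "(\<Prod>i<n. bern (d i) (midx n d j ! i) (0::real)) = (if j = 0 then 1 else 0)" if "j < ?s" for j
  proof (cases "j = 0")
    case True
    then show ?thesis by (simp add: zero bern_def)
  next
    case False
    then have "midx n d j \<noteq> replicate n 0"
      using inj_onD[OF bij_betw_imp_inj_on[OF bij_midx[of n d]], of j 0] pos that zero by auto
    then obtain i where "i < n" "midx n d j ! i \<noteq> 0"
      using bij_betwE[OF bij_midx[of n d], rule_format, of j] \<open>j < ?s\<close>
        nth_equalityI[of "midx n d j" "replicate n 0"] by auto
    then show ?thesis
      using False by (auto simp: bern_def)
  qed
  then have "bern_eval n d c (\<lambda>_. 0) = (\<Sum>j<?s. if j = 0 then real_of_rat (c $ j) else 0)"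
    unfolding tensor_comb_def by (intro sum.cong) auto
  then show ?thesis
    using pos by simp
qed

text \<open>On the unit cube the Bernstein polynomials are nonnegative and sum to \<open>1\<close>, so the value is a
  convex combination of the coordinates.\<close>

lemma bern_eval_bounds:
  assumes x: "\<And>i. i < n \<Longrightarrow> 0 \<le> x i \<and> x i \<le> 1"
  shows "real_of_rat (Min ((\<lambda>j. c $ j) ` {..<bernstein_dim n d})) \<le> bern_eval n d c x"
    and "bern_eval n d c x \<le> real_of_rat (Max ((\<lambda>j. c $ j) ` {..<bernstein_dim n d}))"
proof -
  let ?s = "bernstein_dim n d"
  let ?B = "\<lambda>j. \<Prod>i<n. bern (d i) (midx n d j ! i) (x i)"
  have nonneg: "0 \<le> ?B j" for j
    using x by (intro prod_nonneg) (auto simp: bern_def)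
  have one: "(\<Sum>j<?s. ?B j) = 1"
    using prod_sum_multi_indices[of "\<lambda>i k. bern (d i) k (x i)" d n] by (simp add: sum_bern)
  have "(\<Sum>j<?s. real_of_rat (Min ((\<lambda>j. c $ j) ` {..<?s})) * ?B j) \<le> bern_eval n d c x"
    unfolding tensor_comb_def
    by (intro sum_mono mult_right_mono nonneg) (auto simp: of_rat_less_eq)
  then show "real_of_rat (Min ((\<lambda>j. c $ j) ` {..<?s})) \<le> bern_eval n d c x"
    by (simp add: one flip: sum_distrib_left)
  have "bern_eval n d c x \<le> (\<Sum>j<?s. real_of_rat (Max ((\<lambda>j. c $ j) ` {..<?s})) * ?B j)"
    unfolding tensor_comb_def
    by (intro sum_mono mult_right_mono nonneg) (auto simp: of_rat_less_eq)
  then show "bern_eval n d c x \<le> real_of_rat (Max ((\<lambda>j. c $ j) ` {..<?s}))"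
    by (simp add: one flip: sum_distrib_left)
qed

lemma mpoly_subst_eq_sum_lessThan:
  assumes "q \<in> mpolys_le n d"
  shows "mpoly_subst h x q = (\<Sum>m\<in>Poly_Mapping.keys q.
    h (Poly_Mapping.lookup q m) * (\<Prod>i<n. x i ^ Poly_Mapping.lookup m i))"
  unfolding mpoly_subst_def
  using assms by (intro sum.cong refl) (auto simp: mpolys_le_def prod_keys_superset[of "{..<n}"])

lemma mpoly_subst_cong:
  assumes "q \<in> mpolys_le n d" "\<And>i. i < n \<Longrightarrow> x i = y i"
  shows "mpoly_subst h x q = mpoly_subst h y q"
  using assms by (simp add: mpoly_subst_eq_sum_lessThan)

lemma mpoly_subst_of_int_rat:
  "real_of_rat (mpoly_subst of_int x q) = mpoly_subst of_int (\<lambda>i. real_of_rat (x i)) q"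
  by (simp add: mpoly_subst_def of_rat_sum of_rat_prod of_rat_mult of_rat_power)

text \<open>The coordinates are those of \<open>q\<close> composed with an affine map with rational coefficients. They are
  found one monomial of \<open>q\<close> at a time: each becomes a product over the variables of powers of affine forms, of
  degree at most \<open>d i\<close>.\<close>

lemma ex_bernstein_coords:
  fixes \<alpha> \<gamma> :: "nat \<Rightarrow> rat"
  assumes q: "q \<in> mpolys_le n d"
  shows "\<exists>c\<in>carrier_vec (bernstein_dim n d). \<forall>x. bern_eval n d c x =
    mpoly_subst of_int (\<lambda>i. real_of_rat (\<alpha> i) + real_of_rat (\<gamma> i) * x i) q"
proof -
  let ?s = "bernstein_dim n d"
  note h = comm_ring_hom_real_of_rat
  define e where "e m i = bern_coeff (d i) ([:\<alpha> i, \<gamma> i:] ^ Poly_Mapping.lookup m i)" for m :: "nat \<Rightarrow>\<^sub>0 nat" and i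
  define c where "c = vec ?s (\<lambda>j. \<Sum>m\<in>Poly_Mapping.keys q.
    of_int (Poly_Mapping.lookup q m) * (\<Prod>i<n. e m i (midx n d j ! i)))"
  have "bern_eval n d c x = mpoly_subst of_int (\<lambda>i. real_of_rat (\<alpha> i) + real_of_rat (\<gamma> i) * x i) q" for x
  proof -
    have "(\<Prod>i<n. (real_of_rat (\<alpha> i) + real_of_rat (\<gamma> i) * x i) ^ Poly_Mapping.lookup m i) =
        (\<Sum>j<?s. real_of_rat (\<Prod>i<n. e m i (midx n d j ! i)) * (\<Prod>i<n. bern (d i) (midx n d j ! i) (x i)))"
      if "m \<in> Poly_Mapping.keys q" for m
    proof -
      have "(real_of_rat (\<alpha> i) + real_of_rat (\<gamma> i) * x i) ^ Poly_Mapping.lookup m i =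
          (\<Sum>l\<le>d i. real_of_rat (e m i l) * bern (d i) l (x i))" if "i < n" for i
      proof -
        have "Poly_Mapping.lookup m i \<le> d i"
          using q that \<open>m \<in> _\<close> by (auto simp: mpolys_le_def)
        then have "degree ([:\<alpha> i, \<gamma> i:] ^ Poly_Mapping.lookup m i) \<le> d i"
          using degree_affine_power order_trans by blast
        from poly_eq_sum_bern[OF h this, of "x i"] show ?thesis
          by (simp add: map_poly_affine(1)[OF h] e_def)
      qed
      then show ?thesis
        by (simp add: prod_sum_multi_indices prod.distrib of_rat_prod)
    qed
    then have "mpoly_subst of_int (\<lambda>i. real_of_rat (\<alpha> i) + real_of_rat (\<gamma> i) * x i) q =
        (\<Sum>j<?s. \<Sum>m\<in>Poly_Mapping.keys q. real_of_int (Poly_Mapping.lookup q m) *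
          (real_of_rat (\<Prod>i<n. e m i (midx n d j ! i)) * (\<Prod>i<n. bern (d i) (midx n d j ! i) (x i))))"
      by (subst sum.swap) (simp add: mpoly_subst_eq_sum_lessThan[OF q] sum_distrib_left)
    also have "\<dots> = bern_eval n d c x"
      by (simp add: tensor_comb_def c_def of_rat_sum of_rat_mult sum_distrib_right mult.assoc)
    finally show ?thesis ..
  qed
  moreover have "c \<in> carrier_vec ?s"
    by (simp add: c_def)
  ultimately show ?thesis by blast
qed

section \<open>Subdivision matrices\<close>

text \<open>The matrix of the lower half (\<open>b = False\<close>) or upper half (\<open>b = True\<close>) of the unit cube in
  direction \<open>i\<close>, over the rational numbers. Sides are represented by truth values because they will be binary
  digits.\<close>

definition half_mat :: "nat \<Rightarrow> (nat \<Rightarrow> nat) \<Rightarrow> nat \<times> bool \<Rightarrow> rat mat" where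
  "half_mat n d = (\<lambda>(i, b). box_coeff_mat n d ((\<lambda>_. 0)(i := if b then 1/2 else 0)) ((\<lambda>_. 1)(i := 1/2)))"

definition half_point :: "nat \<times> bool \<Rightarrow> (nat \<Rightarrow> real) \<Rightarrow> nat \<Rightarrow> real" where
  "half_point = (\<lambda>(i, b) x. x(i := (x i + of_bool b) / 2))"

lemma half_mat_carrier [simp]: "half_mat n d ib \<in> carrier_mat (bernstein_dim n d) (bernstein_dim n d)"
  by (simp add: half_mat_def box_coeff_mat_def split: prod.split)

lemma half_matrix_eq:
  "half_matrix n d i (if b then Right else Left) = map_mat real_of_rat (half_mat n d (i, b))"
  by (auto simp: half_mat_def map_mat_box_coeff_mat box_matrix_eq of_rat_divide
      intro!: arg_cong2[where f = "box_coeff_mat n d"])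

lemma bern_eval_half_mat:
  assumes "c \<in> carrier_vec (bernstein_dim n d)"
  shows "bern_eval n d (half_mat n d ib *\<^sub>v c) x = bern_eval n d c (half_point ib x)"
proof (cases ib)
  case (Pair i b)
  show ?thesis
    unfolding Pair half_mat_def prod.case
    by (subst tensor_comb_bern_affine[OF comm_ring_hom_real_of_rat assms, symmetric])
       (auto simp: half_point_def of_rat_divide add_divide_distrib intro!: bern_eval_cong)
qed

definition half_mats :: "nat \<Rightarrow> (nat \<Rightarrow> nat) \<Rightarrow> (nat \<times> bool) list \<Rightarrow> rat mat" where
  "half_mats n d ops = foldr (*) (map (half_mat n d) ops) (1\<^sub>m (bernstein_dim n d))"

lemma half_mats_carrier [simp]: "half_mats n d ops \<in> carrier_mat (bernstein_dim n d) (bernstein_dim n d)"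
  by (induction ops) (auto simp: half_mats_def intro!: mult_carrier_mat[OF half_mat_carrier])

text \<open>The leftmost matrix of the product is applied last to the coordinates, so its affine map acts
  first on the point. This is why the order of the list agrees with that of \<open>fold\<close>.\<close>

lemma bern_eval_half_mats:
  assumes "c \<in> carrier_vec (bernstein_dim n d)"
  shows "bern_eval n d (half_mats n d ops *\<^sub>v c) x = bern_eval n d c (fold half_point ops x)"
proof (induction ops arbitrary: x)
  case Nil
  then show ?case using assms by (simp add: half_mats_def)
next
  case (Cons ib ops)
  have "half_mats n d (ib # ops) *\<^sub>v c = half_mat n d ib *\<^sub>v (half_mats n d ops *\<^sub>v c)"
    using assoc_mult_mat_vec[OF half_mat_carrier half_mats_carrier assms]
    by (simp add: half_mats_def)
  then show ?case
    using Cons assms by (simp add: bern_eval_half_mat mult_mat_vec_carrier[OF half_mats_carrier])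
qed

lemma map_mat_half_mats:
  "map_mat real_of_rat (half_mats n d ops) =
     foldr (*) (map (map_mat real_of_rat \<circ> half_mat n d) ops) (1\<^sub>m (bernstein_dim n d))"
proof (induction ops)
  case Nil
  then show ?case by (simp add: half_mats_def of_rat_hom.mat_hom_one)
next
  case (Cons ib ops)
  have "half_mats n d (ib # ops) = half_mat n d ib * half_mats n d ops"
    by (simp add: half_mats_def)
  then show ?case
    using Cons by (simp add: of_rat_hom.mat_hom_mult[OF half_mat_carrier half_mats_carrier])
qed

text \<open>Least significant digits come first: the map applied to a point last is the one that sends
  the whole interval to one of its halves, so it carries the leading digit of the position.\<close>

definition bit_ops :: "nat \<Rightarrow> (nat \<Rightarrow> nat) \<Rightarrow> (nat \<Rightarrow> nat) \<Rightarrow> (nat \<times> bool) list" where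
  "bit_ops n m l = concat (map (\<lambda>i. map (\<lambda>j. (i, odd (l i div 2 ^ j))) [0..<m i]) [0..<n])"

lemma is_subdivision_matrix_bit_ops:
  "is_subdivision_matrix n d m (map_mat real_of_rat (half_mats n d (bit_ops n m l)))"
  unfolding is_subdivision_matrix_def map_mat_half_mats
  by (rule exI[of _ "\<lambda>i j. if odd (l i div 2 ^ j) then Right else Left"])
     (simp add: bit_ops_def map_concat comp_def half_matrix_eq)

text \<open>Halving after adding a digit, \<open>m\<close> times, writes the fraction \<open>l / 2 ^ m\<close> in binary and scales
  \<open>x i\<close> by \<open>1 / 2 ^ m\<close>.\<close>

lemma fold_half_point_bits:
  "fold half_point (map (\<lambda>j. (i, odd (l div 2 ^ j))) [0..<m]) x = x(i := (x i + real (l mod 2 ^ m)) / 2 ^ m)"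
proof (induction m)
  case (Suc m)
  have "real (l mod 2 ^ Suc m) = 2 ^ m * of_bool (odd (l div 2 ^ m)) + real (l mod 2 ^ m)"
    using mod_mult2_eq[of l "2 ^ m" 2] by (simp add: mult.commute mod_2_eq_odd)
  then show ?case
    using Suc by (auto simp: half_point_def field_simps)
qed simp

lemma fold_half_point_bit_ops:
  "fold half_point (bit_ops n m l) x = (\<lambda>i. if i < n then (x i + real (l i mod 2 ^ m i)) / 2 ^ m i else x i)"
proof (induction n)
  case (Suc n)
  have "fold half_point (bit_ops (Suc n) m l) x =
      fold half_point (map (\<lambda>j. (n, odd (l n div 2 ^ j))) [0..<m n]) (fold half_point (bit_ops n m l) x)"
    by (simp add: bit_ops_def)
  then show ?case
    by (auto simp: Suc fold_half_point_bits)
qed (simp add: bit_ops_def)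

theorem theorem1p13:
  fixes n r :: nat and d :: "nat \<Rightarrow> nat" and a :: "nat \<Rightarrow> int" and k :: "nat \<Rightarrow> nat"
    and q :: "nat \<Rightarrow> int mpoly"
  assumes "\<And>i. i < r \<Longrightarrow> q i \<in> mpolys_le n d"
  shows "\<exists>v :: rat mat. v \<in> carrier_mat (bernstein_dim n d) r \<and>
    (\<forall>(k' :: nat \<Rightarrow> nat) (l :: nat \<Rightarrow> nat) (z :: nat \<Rightarrow> int).
      (\<forall>i<n. k' i \<le> k i \<and> l i < 2 ^ (k i - k' i) \<and> z i = a i + int (l i) * 2 ^ k' i) \<longrightarrow>
      closed_box n z k' \<subseteq> closed_box n a k \<longrightarrow>
      (\<exists>M :: rat mat. M \<in> carrier_mat (bernstein_dim n d) (bernstein_dim n d) \<and>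
        is_subdivision_matrix n d (\<lambda>i. k i - k' i) (map_mat real_of_rat M) \<and>
        (let w = M * v in
          (\<forall>i<r. w $$ (0, i) = mpoly_subst of_int (\<lambda>j. of_int (z j)) (q i)) \<and>
          (\<forall>i<r. \<forall>x\<in>closed_box n z k'.
             real_of_rat (Min ((\<lambda>j. w $$ (j, i)) ` {..<bernstein_dim n d}))
               \<le> mpoly_subst of_int x (q i) \<and>
             mpoly_subst of_int x (q i)
               \<le> real_of_rat (Max ((\<lambda>j. w $$ (j, i)) ` {..<bernstein_dim n d}))))))"
proof -
  let ?s = "bernstein_dim n d"
  have "\<forall>i\<in>{..<r}. \<exists>c. c \<in> carrier_vec ?s \<and> (\<forall>x. bern_eval n d c x =
      mpoly_subst of_int (\<lambda>j. real_of_int (a j) + 2 ^ k j * x j) (q i))"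
    using ex_bernstein_coords[OF assms, of _ "\<lambda>j. of_int (a j)" "\<lambda>j. 2 ^ k j"]
    by (auto simp: of_rat_power Bex_def)
  from bchoice[OF this] obtain C where C: "\<And>i. i < r \<Longrightarrow> C i \<in> carrier_vec ?s"
    and evalC: "\<And>i x. i < r \<Longrightarrow> bern_eval n d (C i) x =
      mpoly_subst of_int (\<lambda>j. real_of_int (a j) + 2 ^ k j * x j) (q i)"
    by auto
  define v where "v = mat ?s r (\<lambda>(j, i). C i $ j)"
  show ?thesis
  proof (rule exI[of _ v], intro conjI allI impI)
    show v: "v \<in> carrier_mat ?s r"
      by (simp add: v_def)
    have colv: "col v i = C i" if "i < r" for i
      using C[OF that] that by (auto simp: v_def)
    fix k' l :: "nat \<Rightarrow> nat" and z :: "nat \<Rightarrow> int"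
    assume z: "\<forall>i<n. k' i \<le> k i \<and> l i < 2 ^ (k i - k' i) \<and> z i = a i + int (l i) * 2 ^ k' i"
    define M where "M = half_mats n d (bit_ops n (\<lambda>i. k i - k' i) l)"
    have M: "M \<in> carrier_mat ?s ?s"
      by (simp add: M_def)
    have w: "(M * v) $$ (j, i) = (M *\<^sub>v C i) $ j" if "j < ?s" "i < r" for j i
      using that M v by (simp add: colv)
    have evalM: "bern_eval n d (M *\<^sub>v C i) x =
        mpoly_subst of_int (\<lambda>j. real_of_int (z j) + 2 ^ k' j * x j) (q i)" if "i < r" for i x
    proof -
      \<comment> \<open>The map from the unit interval onto the \<open>j\<close>-th side of the large box, applied to the dyadic
        subinterval number \<open>l j\<close>, is the map onto the \<open>j\<close>-th side of the small box.\<close>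
      have "real_of_int (a j) + 2 ^ k j * ((x j + real (l j mod 2 ^ (k j - k' j))) / 2 ^ (k j - k' j)) =
          real_of_int (z j) + 2 ^ k' j * x j" if "j < n" for j
      proof -
        have "(2::real) ^ k j = 2 ^ k' j * 2 ^ (k j - k' j)"
          using z that by (simp flip: power_add)
        then show ?thesis
          using z that by (simp add: distrib_left add_divide_distrib)
      qed
      then show ?thesis
        unfolding M_def bern_eval_half_mats[OF C[OF that]] evalC[OF that] fold_half_point_bit_ops
        by (intro mpoly_subst_cong[OF assms[OF that]]) simp
    qed
    have "(M * v) $$ (0, i) = mpoly_subst of_int (\<lambda>j. of_int (z j)) (q i)" if "i < r" for i
    proof -
      have "real_of_rat ((M * v) $$ (0, i)) = bern_eval n d (M *\<^sub>v C i) (\<lambda>_. 0)"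
        using that by (simp add: bern_eval_0 w bernstein_dim_def)
      also have "\<dots> = real_of_rat (mpoly_subst of_int (\<lambda>j. of_int (z j)) (q i))"
        by (simp add: evalM[OF that] mpoly_subst_of_int_rat)
      finally show ?thesis by simp
    qed
    moreover have "real_of_rat (Min ((\<lambda>j. (M * v) $$ (j, i)) ` {..<?s})) \<le> mpoly_subst of_int x (q i) \<and>
        mpoly_subst of_int x (q i) \<le> real_of_rat (Max ((\<lambda>j. (M * v) $$ (j, i)) ` {..<?s}))"
      if "i < r" and x: "x \<in> closed_box n z k'" for i x
    proof -
      define y where "y j = (x j - real_of_int (z j)) / 2 ^ k' j" for j
      have y: "0 \<le> y j \<and> y j \<le> 1" if "j < n" for j
        using x that by (auto simp: y_def closed_box_def PiE_iff Pi_iff field_simps)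
      have "mpoly_subst of_int x (q i) = bern_eval n d (M *\<^sub>v C i) y"
        by (simp add: evalM[OF \<open>i < r\<close>] y_def)
      moreover have "(\<lambda>j. (M * v) $$ (j, i)) ` {..<?s} = (\<lambda>j. (M *\<^sub>v C i) $ j) ` {..<?s}"
        using \<open>i < r\<close> by (auto simp: w)
      ultimately show ?thesis
        using bern_eval_bounds[where x = y, OF y] by simp
    qed
    ultimately show "\<exists>M. M \<in> carrier_mat ?s ?s \<and>
        is_subdivision_matrix n d (\<lambda>i. k i - k' i) (map_mat real_of_rat M) \<and>
        (let w = M * v in
          (\<forall>i<r. w $$ (0, i) = mpoly_subst of_int (\<lambda>j. of_int (z j)) (q i)) \<and>
          (\<forall>i<r. \<forall>x\<in>closed_box n z k'.
             real_of_rat (Min ((\<lambda>j. w $$ (j, i)) ` {..<?s})) \<le> mpoly_subst of_int x (q i) \<and>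
             mpoly_subst of_int x (q i) \<le> real_of_rat (Max ((\<lambda>j. w $$ (j, i)) ` {..<?s}))))"
      using M is_subdivision_matrix_bit_ops[of n d "\<lambda>i. k i - k' i" l]
      by (intro exI[of _ M]) (simp add: M_def)
  qed
qed

end
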